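(* Let $\widehat L>3$ be an integer, let $\alpha\in\{1,-1\}$ and let $\varphi,\psi\in\mathbb R\setminus\{0\}$. Let $C\in\mathbb R^{\widehat L\times\widehat L}$ be the matrix with all diagonal entries equal to $1$, all first-subdiagonal entries equal to $-\varphi$, top-right entry (row $1$, column $\widehat L$) equal to $-\alpha\varphi$, and all other entries $0$. Let $I$ be the $\widehat L\times\widehat L$ identity matrix, and let $R\in\mathbb R^{2\widehat L\times 2\widehat L}$ be the matrix whose only non-zero entries are the entry in row $1$, column $\widehat L$ and the entry in row $2\widehat L$, column $\widehat L+1$, both equal to $\alpha\varphi$. Then the $2\widehat L\times 2\widehat L$ matrix $$M=\begin{bmatrix} C & \psi I\\ -\psi I & C^{\top}\end{bmatrix}^{-1}R$$ has only two potentially non-zero eigenvalues $\omega_1,\omega_2$ (all its other eigenvalues, counted with algebraic multiplicity, are zero). Specifically, $$\omega_{\{1,2\}}=\frac{1}{z_2-z_1}\left(\frac{z_1-\varphi\pm\psi\mathrm i}{1-\alpha z_1^{\widehat L}}-\frac{z_2-\varphi\pm\psi\mathrm i}{1-\alpha z_2^{\widehat L}}\right),$$ where $$z_{\{1,2\}}=\frac{1+\varphi^2+\psi^2\pm\sqrt{(1+\varphi^2+\psi^2)^2-4\varphi^2}}{2\varphi}.$$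
   Context: Notation: $\mathrm i$ is the imaginary unit. In the formula for $z_{\{1,2\}}$, $z_1$ takes the sign $+$ and $z_2$ the sign $-$. In the formula for $\omega_{\{1,2\}}$, $\omega_1$ takes the sign $+$ in both occurrences of $\pm$, and $\omega_2$ takes the sign $-$ in both occurrences. *)

theory Defs
  imports "Jordan_Normal_Form.Spectral_Radius" "Jordan_Normal_Form.Gauss_Jordan_Elimination"
begin

(* Matrix indices are 0-based: entry (i, j) below is row i + 1, column j + 1 of the usual notation. *)

definition C_mat :: "nat \<Rightarrow> real \<Rightarrow> real \<Rightarrow> real mat" where
  "C_mat L \<alpha> \<phi> = mat L L (\<lambda>(i, j).
     if i = j then 1
     else if i = j + 1 then - \<phi>
     else if i = 0 \<and> j = L - 1 then - (\<alpha> * \<phi>)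
     else 0)"

definition R_mat :: "nat \<Rightarrow> real \<Rightarrow> real \<Rightarrow> real mat" where
  "R_mat L \<alpha> \<phi> = mat (2 * L) (2 * L) (\<lambda>(i, j).
     if (i = 0 \<and> j = L - 1) \<or> (i = 2 * L - 1 \<and> j = L) then \<alpha> * \<phi> else 0)"

definition A_mat :: "nat \<Rightarrow> real \<Rightarrow> real \<Rightarrow> real \<Rightarrow> real mat" where
  "A_mat L \<alpha> \<phi> \<psi> = four_block_mat
     (C_mat L \<alpha> \<phi>) (\<psi> \<cdot>\<^sub>m 1\<^sub>m L)
     (- (\<psi> \<cdot>\<^sub>m 1\<^sub>m L)) (transpose_mat (C_mat L \<alpha> \<phi>))"

(* mat_inverse returns None on a singular matrix, so M_mat is meaningful only when A_mat is
   invertible. *)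
definition M_mat :: "nat \<Rightarrow> real \<Rightarrow> real \<Rightarrow> real \<Rightarrow> real mat" where
  "M_mat L \<alpha> \<phi> \<psi> = the (mat_inverse (A_mat L \<alpha> \<phi> \<psi>)) * R_mat L \<alpha> \<phi>"

(* The complex eigenvalues of a real matrix, each repeated according to its algebraic
   multiplicity (its order as a root of the characteristic polynomial). *)
definition eigvals_mset :: "real mat \<Rightarrow> complex multiset" where
  "eigvals_mset A = proots (char_poly (map_mat complex_of_real A))"

lemma set_eigvals_mset:
  assumes "A \<in> carrier_mat n n"
  shows "set_mset (eigvals_mset A) = spectrum (map_mat complex_of_real A)"
proof -
  have A: "map_mat complex_of_real A \<in> carrier_mat n n" using assms by simp
  have "char_poly (map_mat complex_of_real A) \<noteq> 0"
    using degree_monic_char_poly[OF A] by auto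
  then show ?thesis
    using eigenvalue_root_char_poly[OF A] by (auto simp: eigvals_mset_def spectrum_def)
qed

lemma size_eigvals_mset:
  assumes "A \<in> carrier_mat n n"
  shows "size (eigvals_mset A) = n"
proof -
  have A: "map_mat complex_of_real A \<in> carrier_mat n n" using assms by simp
  show ?thesis
    using degree_monic_char_poly[OF A] by (simp add: eigvals_mset_def size_proots_complex)
qed

definition z1 :: "real \<Rightarrow> real \<Rightarrow> real" where
  "z1 \<phi> \<psi> = (1 + \<phi>\<^sup>2 + \<psi>\<^sup>2 + sqrt ((1 + \<phi>\<^sup>2 + \<psi>\<^sup>2)\<^sup>2 - 4 * \<phi>\<^sup>2)) / (2 * \<phi>)"

definition z2 :: "real \<Rightarrow> real \<Rightarrow> real" where
  "z2 \<phi> \<psi> = (1 + \<phi>\<^sup>2 + \<psi>\<^sup>2 - sqrt ((1 + \<phi>\<^sup>2 + \<psi>\<^sup>2)\<^sup>2 - 4 * \<phi>\<^sup>2)) / (2 * \<phi>)"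

definition omega1 :: "nat \<Rightarrow> real \<Rightarrow> real \<Rightarrow> real \<Rightarrow> complex" where
  "omega1 L \<alpha> \<phi> \<psi> = (let w1 = complex_of_real (z1 \<phi> \<psi>); w2 = complex_of_real (z2 \<phi> \<psi>) in
     1 / (w2 - w1) * ((w1 - of_real \<phi> + of_real \<psi> * \<i>) / (1 - of_real \<alpha> * w1 ^ L)
                    - (w2 - of_real \<phi> + of_real \<psi> * \<i>) / (1 - of_real \<alpha> * w2 ^ L)))"

definition omega2 :: "nat \<Rightarrow> real \<Rightarrow> real \<Rightarrow> real \<Rightarrow> complex" where
  "omega2 L \<alpha> \<phi> \<psi> = (let w1 = complex_of_real (z1 \<phi> \<psi>); w2 = complex_of_real (z2 \<phi> \<psi>) in
     1 / (w2 - w1) * ((w1 - of_real \<phi> - of_real \<psi> * \<i>) / (1 - of_real \<alpha> * w1 ^ L)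
                    - (w2 - of_real \<phi> - of_real \<psi> * \<i>) / (1 - of_real \<alpha> * w2 ^ L)))"

(* The next lemmas show that the square root is taken of a positive number and that no
   denominator in omega1 and omega2 vanishes, so Isabelle's totalised sqrt and division
   are harmless there. *)

lemma discriminant_pos:
  fixes \<phi> \<psi> :: real
  assumes "\<psi> \<noteq> 0"
  shows "(1 + \<phi>\<^sup>2 + \<psi>\<^sup>2)\<^sup>2 - 4 * \<phi>\<^sup>2 > 0"
proof -
  have "(1 + \<phi>\<^sup>2 + \<psi>\<^sup>2)\<^sup>2 - 4 * \<phi>\<^sup>2 = ((1 + \<phi>)\<^sup>2 + \<psi>\<^sup>2) * ((1 - \<phi>)\<^sup>2 + \<psi>\<^sup>2)"
    by (simp add: power2_eq_square algebra_simps)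
  moreover have "(1 + \<phi>)\<^sup>2 + \<psi>\<^sup>2 > 0" "(1 - \<phi>)\<^sup>2 + \<psi>\<^sup>2 > 0"
    using assms by (auto intro: add_nonneg_pos)
  ultimately show ?thesis by simp
qed

lemma z1_neq_z2:
  assumes "\<phi> \<noteq> 0" "\<psi> \<noteq> 0"
  shows "z1 \<phi> \<psi> \<noteq> z2 \<phi> \<psi>"
  using assms discriminant_pos[OF assms(2), of \<phi>] by (simp add: z1_def z2_def)

lemma z1_times_z2:
  assumes "\<phi> \<noteq> 0" "\<psi> \<noteq> 0"
  shows "z1 \<phi> \<psi> * z2 \<phi> \<psi> = 1"
proof -
  define s where "s = 1 + \<phi>\<^sup>2 + \<psi>\<^sup>2"
  define d where "d = sqrt (s\<^sup>2 - 4 * \<phi>\<^sup>2)"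
  have "d\<^sup>2 = s\<^sup>2 - 4 * \<phi>\<^sup>2"
    using discriminant_pos[OF assms(2), of \<phi>] by (simp add: d_def s_def)
  then have "(s + d) * (s - d) = 4 * \<phi>\<^sup>2" by (simp add: power2_eq_square algebra_simps)
  then show ?thesis
    using assms(1) by (simp add: z1_def z2_def flip: s_def d_def) (simp add: power2_eq_square)
qed

lemma omega_denominators:
  assumes "L > 0" "\<alpha> = 1 \<or> \<alpha> = - 1" "\<phi> \<noteq> 0" "\<psi> \<noteq> 0"
  shows "1 - \<alpha> * z1 \<phi> \<psi> ^ L \<noteq> 0" "1 - \<alpha> * z2 \<phi> \<psi> ^ L \<noteq> 0"
proof -
  have *: "1 - \<alpha> * x ^ L \<noteq> 0" if "x * y = 1" "x \<noteq> y" for x y :: real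
  proof
    assume "1 - \<alpha> * x ^ L = 0"
    then have "\<bar>x ^ L\<bar> = 1" using assms(2) by auto
    then have "\<bar>x\<bar> ^ L = 1" by (simp add: power_abs)
    then have "\<bar>x\<bar> = 1" using assms(1)
      by (metis abs_ge_zero power_eq_1_iff abs_idempotent real_norm_def less_irrefl)
    then show False using that by (auto simp: abs_if split: if_splits)
  qed
  have p: "z1 \<phi> \<psi> * z2 \<phi> \<psi> = 1" and n: "z1 \<phi> \<psi> \<noteq> z2 \<phi> \<psi>"
    using z1_times_z2 z1_neq_z2 assms by blast+
  show "1 - \<alpha> * z1 \<phi> \<psi> ^ L \<noteq> 0"
    using *[OF p n] .
  show "1 - \<alpha> * z2 \<phi> \<psi> ^ L \<noteq> 0"
    using *[OF p[unfolded mult.commute[of "z1 \<phi> \<psi>"]] n[symmetric]] .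
qed

end

theory Submission
  imports Defs
begin

text \<open>
  Write \<open>A\<close> for the block matrix that is inverted. Only two columns of \<open>R\<close> are non-zero, and they are
  multiples of the first and the last unit vector, so \<open>A\<^sup>-\<^sup>1 R\<close> has rank at most two: it is \<open>U V\<close>, where
  the two columns \<open>u, w\<close> of \<open>U\<close> are mapped by \<open>A\<close> to these two unit vectors, and \<open>V\<close> reads off the
  two middle entries of a vector and scales them by \<open>\<alpha> \<phi>\<close>. By \<open>char_poly_mult_swap\<close>, the
  characteristic polynomial of \<open>U V\<close> is that of the two by two matrix \<open>V U\<close> times a power of \<open>X\<close>,
  which accounts for the zero eigenvalues with their multiplicities.

  To make \<open>A u\<close> the first unit vector, write \<open>u = (x, y)\<close>. The lower half reads \<open>\<psi> x = C\<^sup>T y\<close>, and then the upper half says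
  that \<open>y\<close> satisfies the three-term recurrence \<open>\<phi> (y\<^sub>k\<^sub>+\<^sub>1 + y\<^sub>k\<^sub>-\<^sub>1) = (1 + \<phi>\<^sup>2 + \<psi>\<^sup>2) y\<^sub>k\<close>, with a source at the first
  index and the \<open>\<alpha>\<close>-periodic boundary condition \<open>y\<^sub>L = \<alpha> y\<^sub>0\<close>. The roots of its characteristic equation are \<open>z\<^sub>1\<close> and
  \<open>z\<^sub>2\<close>; they satisfy \<open>z\<^sub>1 z\<^sub>2 = 1\<close>, and the solution is the multiple \<open>corner_y\<close> of the periodic Green
  function \<open>green\<close>. Conjugation by the reversal of all \<open>2 L\<close> coordinates, followed by a sign change of half of
  them, turns \<open>A\<close> into itself, because \<open>C\<close> is a Toeplitz matrix; this symmetry carries \<open>u\<close> to \<open>w\<close>. Hence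
  \<open>V U\<close> has the shape of the real two by two matrix of multiplication by the complex number \<open>a + \<i> \<alpha> b\<close>, and
  its eigenvalues are \<open>a + \<i> b\<close> and \<open>a - \<i> b\<close>. The values of \<open>green\<close> at 0 and 1 identify them as \<open>\<omega>\<^sub>1\<close> and \<open>\<omega>\<^sub>2\<close>.

  Invertibility of \<open>A\<close> is a separate fact about skew blocks, \<open>det_skew_block_nonzero\<close>.
\<close>

section \<open>Characteristic polynomials\<close>

text \<open>
  Sylvester's identity. Both sides are \<open>X\<^sup>m\<close> times the determinant of the matrix with blocks
  \<open>X I, U, V, I\<close>: clearing its lower left block by column operations leaves \<open>X I - U V\<close>
  in the upper left, and multiplying the lower rows by \<open>X\<close> and clearing it by row operations leaves
  \<open>X I - V U\<close> in the lower right.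
\<close>
lemma char_poly_mult_swap:
  fixes U V :: "'a :: idom mat"
  assumes U: "U \<in> carrier_mat n m" and V: "V \<in> carrier_mat m n"
  shows "char_poly (U * V) * [:0, 1:] ^ m = char_poly (V * U) * [:0, 1:] ^ n"
proof -
  define X :: "'a poly" where "X = [:0, 1:]"
  define P where "P = map_mat (\<lambda>a. [:a:]) U"
  define Q where "Q = map_mat (\<lambda>a. [:a:]) V"
  have P: "P \<in> carrier_mat n m" and Q: "Q \<in> carrier_mat m n"
    using U V by (auto simp: P_def Q_def)
  have const_sum: "[:sum f S:] = (\<Sum>i\<in>S. [:f i:])" for f :: "nat \<Rightarrow> 'a" and S
    by (rule poly_eqI) (auto simp: coeff_sum coeff_pCons split: nat.split)
  have PQ: "char_poly (U * V) = det (X \<cdot>\<^sub>m 1\<^sub>m n + - (P * Q))"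
    unfolding char_poly_def char_poly_matrix_def
    using U V
    by (intro arg_cong[where f = det] eq_matI)
       (auto simp: X_def P_def Q_def scalar_prod_def const_sum sum_negf[symmetric] mult.commute)
  have QP: "char_poly (V * U) = det (X \<cdot>\<^sub>m 1\<^sub>m m + - (Q * P))"
    unfolding char_poly_def char_poly_matrix_def
    using U V
    by (intro arg_cong[where f = det] eq_matI)
       (auto simp: X_def P_def Q_def scalar_prod_def const_sum sum_negf[symmetric] mult.commute)
  let ?W = "four_block_mat (X \<cdot>\<^sub>m 1\<^sub>m n) P Q (1\<^sub>m m)"
  (* The lower left block is cleared by S acting on columns and by T acting on rows. *)
  let ?S = "four_block_mat (1\<^sub>m n) (0\<^sub>m n m) (- Q) (1\<^sub>m m)"
  let ?T = "four_block_mat (1\<^sub>m n) (0\<^sub>m n m) (- Q) (X \<cdot>\<^sub>m 1\<^sub>m m)"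
  have car: "?W \<in> carrier_mat (n + m) (n + m)" "?S \<in> carrier_mat (n + m) (n + m)"
    "?T \<in> carrier_mat (n + m) (n + m)"
    using P Q by auto
  have Q_comm: "- Q * (X \<cdot>\<^sub>m 1\<^sub>m n) + X \<cdot>\<^sub>m 1\<^sub>m m * Q = 0\<^sub>m m n"
  proof -
    have "Q * (X \<cdot>\<^sub>m 1\<^sub>m n) = X \<cdot>\<^sub>m Q"
      using Q mult_smult_distrib[OF Q, of "1\<^sub>m n" n X] by simp
    moreover have "X \<cdot>\<^sub>m 1\<^sub>m m * Q = X \<cdot>\<^sub>m Q"
      using Q mult_smult_assoc_mat[of "1\<^sub>m m" m m Q n X] by simp
    ultimately show ?thesis using Q by simp
  qed
  have "?W * ?S = four_block_mat (X \<cdot>\<^sub>m 1\<^sub>m n + - (P * Q)) P (0\<^sub>m m n) (1\<^sub>m m)"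
    using P Q
    by (subst mult_four_block_mat[of _ n n _ m _ m _ _ n _ m])
       (auto intro!: cong_four_block_mat)
  moreover have "det (four_block_mat (X \<cdot>\<^sub>m 1\<^sub>m n + - (P * Q)) P (0\<^sub>m m n) (1\<^sub>m m))
      = det (X \<cdot>\<^sub>m 1\<^sub>m n + - (P * Q))"
    using P Q by (subst det_four_block_mat_lower_left_zero[of _ n _ m]) auto
  moreover have "det ?S = 1"
    using Q by (subst det_four_block_mat_upper_right_zero[of _ n _ m]) auto
  ultimately have W: "det ?W = char_poly (U * V)"
    using det_mult[OF car(1,2)] by (simp add: PQ)
  have "?T * ?W = four_block_mat (X \<cdot>\<^sub>m 1\<^sub>m n) P (0\<^sub>m m n) (X \<cdot>\<^sub>m 1\<^sub>m m + - (Q * P))"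
    using P Q Q_comm
    by (subst mult_four_block_mat[of _ n n _ m _ m _ _ n _ m])
       (auto intro!: cong_four_block_mat simp: comm_add_mat[of _ m m])
  moreover have "det (four_block_mat (X \<cdot>\<^sub>m 1\<^sub>m n) P (0\<^sub>m m n) (X \<cdot>\<^sub>m 1\<^sub>m m + - (Q * P)))
      = X ^ n * char_poly (V * U)"
    using P Q by (subst det_four_block_mat_lower_left_zero[of _ n _ m]) (auto simp: QP)
  moreover have "det ?T = X ^ m"
    using Q by (subst det_four_block_mat_upper_right_zero[of _ n _ m]) auto
  ultimately have "X ^ m * det ?W = X ^ n * char_poly (V * U)"
    using det_mult[OF car(3,1)] by simp
  then show ?thesis
    unfolding W by (simp only: X_def mult.commute)
qed

lemma char_poly_2x2:
  fixes B :: "'a :: comm_ring_1 mat"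
  assumes "B \<in> carrier_mat 2 2"
  shows "char_poly B = [:B $$ (0, 0) * B $$ (1, 1) - B $$ (0, 1) * B $$ (1, 0),
    - (B $$ (0, 0) + B $$ (1, 1)), 1:]"
proof -
  have car: "char_poly_matrix B \<in> carrier_mat 2 2" using assms by simp
  have minor: "det (mat_delete (char_poly_matrix B) i j) = mat_delete (char_poly_matrix B) i j $$ (0, 0)" for i j
    by (rule det_single) (use mat_delete_carrier[OF car] in simp)
  have deleted: "mat_delete (char_poly_matrix B) 0 0 $$ (0, 0) = char_poly_matrix B $$ (1, 1)"
    "mat_delete (char_poly_matrix B) 0 1 $$ (0, 0) = char_poly_matrix B $$ (1, 0)"
    using carrier_matD[OF car] by (simp_all add: mat_delete_def)
  have "char_poly B = (\<Sum>j<2. char_poly_matrix B $$ (0, j) * cofactor (char_poly_matrix B) 0 j)"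
    unfolding char_poly_def using laplace_expansion_row[OF car, of 0] by simp
  also have "\<dots> = char_poly_matrix B $$ (0, 0) * char_poly_matrix B $$ (1, 1)
      - char_poly_matrix B $$ (0, 1) * char_poly_matrix B $$ (1, 0)"
    by (simp add: numeral_2_eq_2 cofactor_def minor deleted[simplified])
  also have "\<dots> = [:B $$ (0, 0) * B $$ (1, 1) - B $$ (0, 1) * B $$ (1, 0),
    - (B $$ (0, 0) + B $$ (1, 1)), 1:]"
    using assms by (simp add: char_poly_matrix_def)
  finally show ?thesis .
qed

section \<open>Invertibility of the block matrix\<close>

lemma smult_one_mult_vec:
  fixes v :: "'a :: comm_ring_1 vec"
  assumes "v \<in> carrier_vec n"
  shows "(c \<cdot>\<^sub>m 1\<^sub>m n) *\<^sub>v v = c \<cdot>\<^sub>v v"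
  using assms by (intro eq_vecI) (auto simp: row_smult)

lemma scalar_prod_self_nonneg: "v \<bullet> v \<ge> (0 :: real)"
  by (simp add: scalar_prod_def sum_nonneg)

lemma scalar_prod_self_eq_0:
  fixes v :: "real vec"
  assumes "v \<in> carrier_vec n" "v \<bullet> v = 0"
  shows "v = 0\<^sub>v n"
  using assms by (intro eq_vecI) (auto simp: scalar_prod_def sum_nonneg_eq_0_iff)

text \<open>
  A kernel vector \<open>(a, b)\<close> satisfies \<open>C a = - \<psi> b\<close> and \<open>C\<^sup>T b = \<psi> a\<close>. Evaluating \<open>b \<bullet> C a = C\<^sup>T b \<bullet> a\<close> by both
  equations gives \<open>- \<psi> (b \<bullet> b) = \<psi> (a \<bullet> a)\<close>, so both squared norms vanish.
\<close>
lemma det_skew_block_nonzero: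
  fixes C :: "real mat"
  assumes C: "C \<in> carrier_mat n n" and "\<psi> \<noteq> 0"
  shows "det (four_block_mat C (\<psi> \<cdot>\<^sub>m 1\<^sub>m n) (- (\<psi> \<cdot>\<^sub>m 1\<^sub>m n)) (transpose_mat C)) \<noteq> 0" (is "det ?A \<noteq> 0")
proof
  assume "det ?A = 0"
  moreover have "?A \<in> carrier_mat (n + n) (n + n)" using C by auto
  ultimately obtain v where v: "v \<in> carrier_vec (n + n)" "v \<noteq> 0\<^sub>v (n + n)" "?A *\<^sub>v v = 0\<^sub>v (n + n)"
    using det_0_iff_vec_prod_zero_field[of ?A "n + n"] by blast
  define a where "a = vec_first v n"
  define b where "b = vec_last v n"
  have ab: "a \<in> carrier_vec n" "b \<in> carrier_vec n" "v = a @\<^sub>v b"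
    using v by (auto simp: a_def b_def)
  have zero_append: "0\<^sub>v (n + n) = 0\<^sub>v n @\<^sub>v (0\<^sub>v n :: real vec)" by auto
  have "?A *\<^sub>v (a @\<^sub>v b) = (C *\<^sub>v a + (\<psi> \<cdot>\<^sub>m 1\<^sub>m n) *\<^sub>v b)
      @\<^sub>v (- (\<psi> \<cdot>\<^sub>m 1\<^sub>m n) *\<^sub>v a + transpose_mat C *\<^sub>v b)"
    using C ab by (intro four_block_mat_mult_vec) auto
  then have "(C *\<^sub>v a + \<psi> \<cdot>\<^sub>v b) @\<^sub>v (- (\<psi> \<cdot>\<^sub>v a) + transpose_mat C *\<^sub>v b) = 0\<^sub>v n @\<^sub>v 0\<^sub>v n"
    using v(3) ab unfolding zero_append by (simp add: smult_one_mult_vec)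
  then have top: "C *\<^sub>v a + \<psi> \<cdot>\<^sub>v b = 0\<^sub>v n"
    and bottom: "- (\<psi> \<cdot>\<^sub>v a) + transpose_mat C *\<^sub>v b = 0\<^sub>v n"
    using C ab by (subst (asm) append_vec_eq[of _ n]; simp)+
  have "0 = b \<bullet> (C *\<^sub>v a + \<psi> \<cdot>\<^sub>v b)" using ab top by simp
  also have "\<dots> = b \<bullet> (C *\<^sub>v a) + \<psi> * (b \<bullet> b)"
    using C ab by (subst scalar_prod_add_distrib[of _ n]) auto
  also have "b \<bullet> (C *\<^sub>v a) = (transpose_mat C *\<^sub>v b) \<bullet> a"
    using C ab by (simp add: transpose_vec_mult_scalar)
  also have "transpose_mat C *\<^sub>v b = \<psi> \<cdot>\<^sub>v a"
  proof (intro eq_vecI)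
    fix i assume "i < dim_vec (\<psi> \<cdot>\<^sub>v a)"
    then show "(transpose_mat C *\<^sub>v b) $ i = (\<psi> \<cdot>\<^sub>v a) $ i"
      using arg_cong[OF bottom, of "\<lambda>v. v $ i"] C ab by simp
  qed (use C ab in simp)
  also have "(\<psi> \<cdot>\<^sub>v a) \<bullet> a + \<psi> * (b \<bullet> b) = \<psi> * (a \<bullet> a + b \<bullet> b)"
    using ab by (simp add: distrib_left)
  finally have "a \<bullet> a + b \<bullet> b = 0" using assms(2) by simp
  then have "a \<bullet> a = 0" "b \<bullet> b = 0"
    using scalar_prod_self_nonneg[of a] scalar_prod_self_nonneg[of b] by linarith+
  then have "a = 0\<^sub>v n" "b = 0\<^sub>v n"
    using ab scalar_prod_self_eq_0 by blast+
  then have "v = 0\<^sub>v (n + n)"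
    by (simp only: ab(3) zero_append)
  with v(2) show False by contradiction
qed

section \<open>The action of the block matrix on a vector\<close>

lemma C_mat_mult_vec:
  assumes "L \<ge> 2" "v \<in> carrier_vec L" "i < L"
  shows "(C_mat L \<alpha> \<phi> *\<^sub>v v) $ i = v $ i - \<phi> * (if i = 0 then \<alpha> * v $ (L - 1) else v $ (i - 1))"
proof -
  have "(C_mat L \<alpha> \<phi> *\<^sub>v v) $ i = (\<Sum>k\<in>{0..<L}. (if k = i then v $ k else 0)
     - \<phi> * (if k = (if i = 0 then L - 1 else i - 1) then (if i = 0 then \<alpha> else 1) * v $ k else 0))"
    using assms by (auto simp: C_mat_def scalar_prod_def intro!: sum.cong)
  also have "\<dots> = v $ i - \<phi> * (if i = 0 then \<alpha> * v $ (L - 1) else v $ (i - 1))"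
    using assms by (simp add: sum_subtractf sum_distrib_left[symmetric] sum.delta)
  finally show ?thesis .
qed

lemma C_mat_transpose_mult_vec:
  assumes "L \<ge> 2" "v \<in> carrier_vec L" "i < L"
  shows "(transpose_mat (C_mat L \<alpha> \<phi>) *\<^sub>v v) $ i = v $ i - \<phi> * (if i = L - 1 then \<alpha> * v $ 0 else v $ (i + 1))"
proof -
  have "(transpose_mat (C_mat L \<alpha> \<phi>) *\<^sub>v v) $ i = (\<Sum>k\<in>{0..<L}. (if k = i then v $ k else 0)
     - \<phi> * (if k = (if i = L - 1 then 0 else i + 1) then (if i = L - 1 then \<alpha> else 1) * v $ k else 0))"
    using assms by (auto simp: C_mat_def scalar_prod_def intro!: sum.cong)
  also have "\<dots> = v $ i - \<phi> * (if i = L - 1 then \<alpha> * v $ 0 else v $ (i + 1))"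
    using assms by (cases "i = L - 1") (simp_all add: sum_subtractf flip: sum_distrib_left)
  finally show ?thesis .
qed

lemma A_mat_mult_vec:
  assumes "L \<ge> 2" "i < 2 * L"
  shows "(A_mat L \<alpha> \<phi> \<psi> *\<^sub>v vec (2 * L) (\<lambda>k. if k < L then x k else y (k - L))) $ i =
    (if i < L then x i - \<phi> * (if i = 0 then \<alpha> * x (L - 1) else x (i - 1)) + \<psi> * y i
     else y (i - L) - \<phi> * (if i = 2 * L - 1 then \<alpha> * y 0 else y (i - L + 1)) - \<psi> * x (i - L))"
proof -
  have C: "C_mat L \<alpha> \<phi> \<in> carrier_mat L L" by (simp add: C_mat_def)
  have split: "vec (2 * L) (\<lambda>k. if k < L then x k else y (k - L)) = vec L x @\<^sub>v vec L y"
    by (intro eq_vecI) auto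
  have "A_mat L \<alpha> \<phi> \<psi> *\<^sub>v (vec L x @\<^sub>v vec L y)
      = (C_mat L \<alpha> \<phi> *\<^sub>v vec L x + (\<psi> \<cdot>\<^sub>m 1\<^sub>m L) *\<^sub>v vec L y)
        @\<^sub>v (- (\<psi> \<cdot>\<^sub>m 1\<^sub>m L) *\<^sub>v vec L x + transpose_mat (C_mat L \<alpha> \<phi>) *\<^sub>v vec L y)"
    unfolding A_mat_def using C by (intro four_block_mat_mult_vec) auto
  then show ?thesis
    unfolding split using assms C
    by (auto simp: smult_one_mult_vec C_mat_mult_vec C_mat_transpose_mult_vec simp del: index_mult_mat_vec)
qed

section \<open>The periodic Green function\<close>

text \<open>
  With \<open>p q = 1\<close>, this is, up to a factor, the Green function of the difference operator
  \<open>f \<mapsto> f\<^sub>k\<^sub>+\<^sub>1 + f\<^sub>k\<^sub>-\<^sub>1 - (p + q) f\<^sub>k\<close> on sequences with \<open>f\<^sub>k\<^sub>+\<^sub>L = \<alpha> f\<^sub>k\<close>. On one period it is a combination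
  of the two solutions \<open>p\<^sup>k\<close> and \<open>q\<^sup>k\<close>; summing the translates by multiples \<open>m L\<close> with weights \<open>\<alpha>\<^sup>m\<close> produces, as in a
  geometric series, the denominators.
\<close>
definition green :: "nat \<Rightarrow> real \<Rightarrow> real \<Rightarrow> real \<Rightarrow> nat \<Rightarrow> real" where
  "green L \<alpha> p q k = p ^ k / (1 - \<alpha> * p ^ L) - q ^ k / (1 - \<alpha> * q ^ L)"

text \<open>
  Multiplying numerator and denominator on the left by \<open>q\<^sup>L\<close> turns \<open>p\<^sup>L\<^sup>-\<^sup>k\<close> into \<open>q\<^sup>k\<close> and \<open>1 - \<alpha> p\<^sup>L\<close> into
  \<open>- \<alpha> (1 - \<alpha> q\<^sup>L)\<close>, since \<open>\<alpha>\<close> is its own inverse.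
\<close>
lemma pole_reflection:
  fixes \<alpha> p q :: real
  assumes "\<alpha> * \<alpha> = 1" "p * q = 1" "1 - \<alpha> * p ^ L \<noteq> 0" "1 - \<alpha> * q ^ L \<noteq> 0" "k \<le> L"
  shows "\<alpha> * (p ^ (L - k) / (1 - \<alpha> * p ^ L)) = - (q ^ k / (1 - \<alpha> * q ^ L))"
proof -
  have 1: "p ^ n * q ^ n = 1" for n using assms(2) by (simp add: power_mult_distrib[symmetric])
  have "p ^ L = p ^ (L - k) * p ^ k" using assms(5) by (simp add: power_add[symmetric])
  then have "q ^ k * p ^ L = p ^ (L - k)"
    using 1[of k] by (metis mult.left_commute mult.commute mult_1)
  moreover have "q ^ L * p ^ (L - k) = q ^ k"
  proof -
    have "q ^ L = q ^ (L - k) * q ^ k" using assms(5) by (simp add: power_add[symmetric])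
    then show ?thesis using 1[of "L - k"] by (metis mult.left_commute mult.commute mult_1)
  qed
  ultimately have "\<alpha> * p ^ (L - k) * (1 - \<alpha> * q ^ L) = - (q ^ k) * (1 - \<alpha> * p ^ L)"
    using assms(1) by (simp add: algebra_simps)
  then show ?thesis using assms(3,4) by (simp add: field_simps)
qed

lemma green_recurrence:
  assumes "p * q = 1"
  shows "green L \<alpha> p q (k + 2) + green L \<alpha> p q k = (p + q) * green L \<alpha> p q (k + 1)"
proof -
  define a where "a = 1 / (1 - \<alpha> * p ^ L)"
  define b where "b = 1 / (1 - \<alpha> * q ^ L)"
  have "green L \<alpha> p q n = p ^ n * a - q ^ n * b" for n
    by (simp add: green_def a_def b_def)
  then have "green L \<alpha> p q (k + 2) + green L \<alpha> p q k
      = (p ^ (k + 2) + p ^ k) * a - (q ^ (k + 2) + q ^ k) * b"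
    and "green L \<alpha> p q (k + 1) = p ^ (k + 1) * a - q ^ (k + 1) * b"
    by (simp_all only: distrib_right)
  moreover have "p ^ (k + 2) + p ^ k = (p + q) * p ^ (k + 1)" "q ^ (k + 2) + q ^ k = (p + q) * q ^ (k + 1)"
    using assms by (simp_all add: algebra_simps)
  ultimately show ?thesis
    by (simp only: right_diff_distrib mult.assoc)
qed

text \<open>
  The case \<open>k = 0\<close> is the periodic boundary condition, and \<open>k = 1\<close> expresses the entry next to the
  boundary through the value of \<open>green\<close> at 1.
\<close>
lemma green_reflection:
  assumes "\<alpha> * \<alpha> = 1" "p * q = 1" "1 - \<alpha> * p ^ L \<noteq> 0" "1 - \<alpha> * q ^ L \<noteq> 0" "k \<le> L"
  shows "\<alpha> * green L \<alpha> p q (L - k) = green L \<alpha> p q k"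
  using pole_reflection[OF assms] pole_reflection[of \<alpha> q p L k] assms
  by (simp add: green_def right_diff_distrib mult.commute)

text \<open>
  The strength of the source at index 0. By reflection the periodic continuation of \<open>green\<close> has the same value at
  \<open>-1\<close> as at \<open>1\<close>, so this is the defect of the three-term recurrence at 0.
\<close>
lemma green_jump:
  assumes "\<alpha> * \<alpha> = 1" "p * q = 1" "1 - \<alpha> * p ^ L \<noteq> 0" "1 - \<alpha> * q ^ L \<noteq> 0"
  shows "(p + q) * green L \<alpha> p q 0 - 2 * green L \<alpha> p q 1 = q - p"
proof -
  define b where "b = 1 / (1 - \<alpha> * q ^ L)"
  have "1 / (1 - \<alpha> * p ^ L) = 1 + \<alpha> * (p ^ L / (1 - \<alpha> * p ^ L))"
    using assms(3) by (simp add: field_simps)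
  then have a: "1 / (1 - \<alpha> * p ^ L) = 1 - b"
    using pole_reflection[OF assms, of 0] by (simp add: b_def)
  have "green L \<alpha> p q k = p ^ k * (1 / (1 - \<alpha> * p ^ L)) - q ^ k * b" for k
    by (simp add: green_def b_def)
  then have "green L \<alpha> p q k = p ^ k * (1 - b) - q ^ k * b" for k
    unfolding a .
  from this[of 0] this[of 1]
  have "green L \<alpha> p q 0 = 1 - 2 * b" and "green L \<alpha> p q 1 = p - (p + q) * b"
    by (simp_all add: algebra_simps)
  then show ?thesis by (simp only:) (simp add: algebra_simps)
qed

section \<open>The first column of the inverse\<close>

text \<open>
  \<open>corner_y\<close> is the lower half of the first column of the inverse of the block matrix, normalised by
  \<open>green_jump\<close>; \<open>corner_x\<close> is the upper half, that is \<open>C\<^sup>T y / \<psi>\<close>.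
\<close>
definition corner_x :: "nat \<Rightarrow> real \<Rightarrow> real \<Rightarrow> real \<Rightarrow> real \<Rightarrow> nat \<Rightarrow> real" where
  "corner_x L \<alpha> \<phi> p q k = (green L \<alpha> p q k - \<phi> * green L \<alpha> p q (k + 1)) / (\<phi> * (q - p))"

definition corner_y :: "nat \<Rightarrow> real \<Rightarrow> real \<Rightarrow> real \<Rightarrow> real \<Rightarrow> real \<Rightarrow> nat \<Rightarrow> real" where
  "corner_y L \<alpha> \<phi> \<psi> p q k = \<psi> * green L \<alpha> p q k / (\<phi> * (q - p))"

lemma corner_bottom:
  assumes "\<alpha> * \<alpha> = 1" "p * q = 1" "1 - \<alpha> * p ^ L \<noteq> 0" "1 - \<alpha> * q ^ L \<noteq> 0"
    and "k < L"
  shows "corner_y L \<alpha> \<phi> \<psi> p q k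
      - \<phi> * (if k = L - 1 then \<alpha> * corner_y L \<alpha> \<phi> \<psi> p q 0 else corner_y L \<alpha> \<phi> \<psi> p q (k + 1))
    = \<psi> * corner_x L \<alpha> \<phi> p q k"
proof -
  have "\<alpha> * green L \<alpha> p q 0 = green L \<alpha> p q L"
    using green_reflection[OF assms(1-4), of L] by simp
  then have wrap: "\<alpha> * corner_y L \<alpha> \<phi> \<psi> p q 0 = corner_y L \<alpha> \<phi> \<psi> p q L"
    by (simp add: corner_y_def)
  have "(if k = L - 1 then \<alpha> * corner_y L \<alpha> \<phi> \<psi> p q 0 else corner_y L \<alpha> \<phi> \<psi> p q (k + 1))
      = corner_y L \<alpha> \<phi> \<psi> p q (k + 1)"
    using wrap assms(5) by auto
  then show ?thesis
    by (simp add: corner_y_def corner_x_def right_diff_distrib diff_divide_distrib mult_ac)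
qed

text \<open>
  Substituting \<open>corner_x\<close> turns row \<open>k\<close> of the upper half into the three-term recurrence for \<open>green\<close>, which holds
  for \<open>k > 0\<close>. In row 0 the wrap-around entry replaces \<open>green\<close> at \<open>-1\<close> by its value at 1, and the
  defect is the jump.
\<close>
lemma corner_top:
  assumes "\<alpha> * \<alpha> = 1" "p * q = 1" "1 - \<alpha> * p ^ L \<noteq> 0" "1 - \<alpha> * q ^ L \<noteq> 0"
    and "\<phi> \<noteq> 0" "p \<noteq> q" "\<phi> * (p + q) = 1 + \<phi>\<^sup>2 + \<psi>\<^sup>2"
    and "k < L"
  shows "corner_x L \<alpha> \<phi> p q k
      - \<phi> * (if k = 0 then \<alpha> * corner_x L \<alpha> \<phi> p q (L - 1) else corner_x L \<alpha> \<phi> p q (k - 1))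
      + \<psi> * corner_y L \<alpha> \<phi> \<psi> p q k
    = (if k = 0 then 1 else 0)"
proof -
  let ?g = "green L \<alpha> p q"
  define D where "D = \<phi> * (q - p)"
  have D: "D \<noteq> 0" using assms(5,6) by (simp add: D_def)
  have x_eq: "corner_x L \<alpha> \<phi> p q n = (?g n - \<phi> * ?g (n + 1)) / D"
    and y_eq: "corner_y L \<alpha> \<phi> \<psi> p q n = \<psi> * ?g n / D" for n
    by (simp_all add: corner_x_def corner_y_def D_def)
  show ?thesis
  proof (cases k)
    case 0
    have "\<alpha> * ?g (L - 1) = ?g 1" "\<alpha> * ?g L = ?g 0"
      using green_reflection[OF assms(1-4), of 1] green_reflection[OF assms(1-4), of 0] assms(8)
      by simp_all
    then have "\<alpha> * (?g (L - 1) - \<phi> * ?g L) = ?g 1 - \<phi> * ?g 0"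
      by (simp add: algebra_simps)
    then have "\<alpha> * corner_x L \<alpha> \<phi> p q (L - 1) = (?g 1 - \<phi> * ?g 0) / D"
      using assms(8) by (simp add: x_eq)
    moreover have "(?g 0 - \<phi> * ?g 1) - \<phi> * (?g 1 - \<phi> * ?g 0) + \<psi> * (\<psi> * ?g 0) = D"
    proof -
      have "(?g 0 - \<phi> * ?g 1) - \<phi> * (?g 1 - \<phi> * ?g 0) + \<psi> * (\<psi> * ?g 0)
          = (1 + \<phi>\<^sup>2 + \<psi>\<^sup>2) * ?g 0 - 2 * \<phi> * ?g 1"
        by (simp add: algebra_simps power2_eq_square)
      also have "\<dots> = \<phi> * ((p + q) * ?g 0 - 2 * ?g 1)"
        unfolding assms(7)[symmetric] by (simp add: algebra_simps)
      finally show ?thesis unfolding green_jump[OF assms(1-4)] D_def .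
    qed
    then have "((?g 0 - \<phi> * ?g 1) - \<phi> * (?g 1 - \<phi> * ?g 0) + \<psi> * (\<psi> * ?g 0)) / D = 1"
      using D by simp
    ultimately show ?thesis
      using 0
      by (simp add: x_eq[of 0] y_eq[of 0] add_divide_distrib diff_divide_distrib right_diff_distrib)
  next
    case (Suc n)
    have "(?g (n + 1) - \<phi> * ?g (n + 2)) - \<phi> * (?g n - \<phi> * ?g (n + 1)) + \<psi> * (\<psi> * ?g (n + 1)) = 0"
    proof -
      have "(?g (n + 1) - \<phi> * ?g (n + 2)) - \<phi> * (?g n - \<phi> * ?g (n + 1)) + \<psi> * (\<psi> * ?g (n + 1))
          = (1 + \<phi>\<^sup>2 + \<psi>\<^sup>2) * ?g (n + 1) - \<phi> * (?g (n + 2) + ?g n)"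
        by (simp add: algebra_simps power2_eq_square)
      also have "\<dots> = 0"
        unfolding assms(7)[symmetric] green_recurrence[OF assms(2)] by simp
      finally show ?thesis .
    qed
    then have "((?g (n + 1) - \<phi> * ?g (n + 2)) - \<phi> * (?g n - \<phi> * ?g (n + 1)) + \<psi> * (\<psi> * ?g (n + 1))) / D = 0"
      by simp
    then show ?thesis
      using Suc
      by (simp add: x_eq y_eq add_divide_distrib diff_divide_distrib right_diff_distrib)
  qed
qed

section \<open>The eigenvalues\<close>

theorem theorem2p1:
  fixes L :: nat and \<alpha> \<phi> \<psi> :: real
  assumes "L > 3"
    and "\<alpha> \<in> {1, -1}"
    and "\<phi> \<noteq> 0"
    and "\<psi> \<noteq> 0"
  shows "invertible_mat (A_mat L \<alpha> \<phi> \<psi>) \<and>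
         eigvals_mset (M_mat L \<alpha> \<phi> \<psi>) =
           {#omega1 L \<alpha> \<phi> \<psi>, omega2 L \<alpha> \<phi> \<psi>#} + replicate_mset (2 * L - 2) 0"
proof -
  define p where "p = z1 \<phi> \<psi>"
  define q where "q = z2 \<phi> \<psi>"
  define x where "x = corner_x L \<alpha> \<phi> p q"
  define y where "y = corner_y L \<alpha> \<phi> \<psi> p q"
  let ?A = "A_mat L \<alpha> \<phi> \<psi>"
  let ?g = "green L \<alpha> p q"
  have sq: "\<alpha> * \<alpha> = 1" using assms(2) by auto
  have pq: "p * q = 1" "p \<noteq> q"
    using z1_times_z2 z1_neq_z2 assms by (simp_all add: p_def q_def)
  have den: "1 - \<alpha> * p ^ L \<noteq> 0" "1 - \<alpha> * q ^ L \<noteq> 0"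
    using omega_denominators[of L \<alpha> \<phi> \<psi>] assms by (auto simp: p_def q_def)
  have sum: "\<phi> * (p + q) = 1 + \<phi>\<^sup>2 + \<psi>\<^sup>2"
    using assms(3) by (simp add: p_def q_def z1_def z2_def field_simps)
  note top = corner_top[OF sq pq(1) den assms(3) pq(2) sum, folded x_def y_def]
  note bottom = corner_bottom[OF sq pq(1) den, of _ \<phi> \<psi>, folded x_def y_def]

  have A: "?A \<in> carrier_mat (2 * L) (2 * L)"
    by (auto simp: A_mat_def C_mat_def mult_2)
  have "det ?A \<noteq> 0"
    unfolding A_mat_def using assms(4) by (intro det_skew_block_nonzero) (simp_all add: C_mat_def)
  then have "?A \<in> Units (ring_mat TYPE(real) (2 * L) ())"
    by (rule det_non_zero_imp_unit[OF A])
  then obtain A' where A': "mat_inverse ?A = Some A'"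
    using mat_inverse(1)[OF A, where b = "()"] by (cases "mat_inverse ?A") auto
  have inv: "?A * A' = 1\<^sub>m (2 * L)" "A' * ?A = 1\<^sub>m (2 * L)" "A' \<in> carrier_mat (2 * L) (2 * L)"
    using mat_inverse(2)[OF A A'] by auto
  have invertible: "invertible_mat ?A"
    unfolding invertible_mat_def inverts_mat_def using A inv by (auto intro!: exI[of _ A'])

  define u where "u = vec (2 * L) (\<lambda>k. if k < L then x k else y (k - L))"
  (* w is u with its coordinates reversed and the sign of the new upper half changed, by the Toeplitz symmetry of C. *)
  define w where "w = vec (2 * L) (\<lambda>k. if k < L then - y (L - 1 - k) else x (L - 1 - (k - L)))"
  have Au: "(?A *\<^sub>v u) $ i = (if i = 0 then 1 else 0)" if "i < 2 * L" for i
  proof (cases "i < L")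
    case True
    then show ?thesis
      using assms(1) top[of i] unfolding u_def by (subst A_mat_mult_vec) auto
  next
    case False
    then have "i - L < L" "i - L = L - 1 \<longleftrightarrow> i = 2 * L - 1" "i \<noteq> 0"
      using that assms(1) by auto
    then show ?thesis
      using assms(1) that False bottom[of "i - L"] unfolding u_def by (subst A_mat_mult_vec) auto
  qed
  have Aw: "(?A *\<^sub>v w) $ i = (if i = 2 * L - 1 then 1 else 0)" if "i < 2 * L" for i
  proof (cases "i < L")
    case True
    define j where "j = L - 1 - i"
    have j: "j < L" "j = L - 1 \<longleftrightarrow> i = 0" "i \<noteq> 2 * L - 1"
      using assms(1) True by (auto simp: j_def)
    (* Row i of the upper half is, up to sign, row j of the lower half of the system for u. *)
    have "(?A *\<^sub>v w) $ i = - y j - \<phi> * (if i = 0 then \<alpha> * - y (L - 1 - (L - 1)) else - y (L - 1 - (i - 1))) + \<psi> * x j"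
      using assms(1) that True unfolding w_def by (subst A_mat_mult_vec) (simp_all add: j_def)
    also have "\<dots> = - (y j - \<phi> * (if j = L - 1 then \<alpha> * y 0 else y (j + 1)) - \<psi> * x j)"
    proof (cases "i = 0")
      case True
      with j show ?thesis by simp
    next
      case False
      moreover have "L - 1 - (i - 1) = j + 1" using False True by (simp add: j_def)
      ultimately show ?thesis using j by simp
    qed
    finally show ?thesis using bottom[OF j(1)] j(3) by simp
  next
    case False
    define j where "j = L - 1 - (i - L)"
    have j: "j < L" "j = 0 \<longleftrightarrow> i = 2 * L - 1" "L - 1 - (i - L + 1) = j - 1"
      using assms(1) that False by (auto simp: j_def)
    have "(?A *\<^sub>v w) $ i = x j - \<phi> * (if i = 2 * L - 1 then \<alpha> * x (L - 1 - 0) else x (L - 1 - (i - L + 1))) - \<psi> * - y j"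
      using assms(1) that False unfolding w_def by (subst A_mat_mult_vec) (simp_all add: j_def)
    also have "\<dots> = x j - \<phi> * (if j = 0 then \<alpha> * x (L - 1) else x (j - 1)) + \<psi> * y j"
      unfolding j(2,3) by simp
    finally show ?thesis using top[OF j(1)] j(2) by simp
  qed

  (* R factors as (A U) V: the columns of A U are the first and the last unit vector. *)
  define U where "U = mat_of_cols (2 * L) [u, w]"
  define V where "V = mat 2 (2 * L)
    (\<lambda>(i, j). if (i = 0 \<and> j = L - 1) \<or> (i = 1 \<and> j = L) then \<alpha> * \<phi> else 0)"
  have U: "U \<in> carrier_mat (2 * L) 2" and V: "V \<in> carrier_mat 2 (2 * L)"
    using mat_of_cols_carrier(1)[of "2 * L" "[u, w]"] by (simp_all add: U_def V_def numeral_2_eq_2)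
  have U_index: "U $$ (k, 0) = u $ k" "U $$ (k, 1) = w $ k" if "k < 2 * L" for k
    using that by (simp_all add: U_def mat_of_cols_index)
  have "col U 0 = u" "col U 1 = w"
    by (simp_all add: U_def u_def w_def)
  then have AU: "(?A * U) $$ (i, 0) = (if i = 0 then 1 else 0)"
    "(?A * U) $$ (i, 1) = (if i = 2 * L - 1 then 1 else 0)" if "i < 2 * L" for i
    using Au[OF that] Aw[OF that] that A U by simp_all
  have mult_V: "(W * V) $$ (i, j) = W $$ (i, 0) * V $$ (0, j) + W $$ (i, 1) * V $$ (1, j)"
    if "W \<in> carrier_mat (2 * L) 2" "i < 2 * L" "j < 2 * L" for W i j
    using that(2,3) carrier_matD[OF that(1)] carrier_matD[OF V]
    by (simp add: scalar_prod_def) (simp add: numeral_2_eq_2)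
  have "R_mat L \<alpha> \<phi> = ?A * U * V"
  proof (intro eq_matI)
    fix i j assume "i < dim_row (?A * U * V)" "j < dim_col (?A * U * V)"
    then have ij: "i < 2 * L" "j < 2 * L" using A V by auto
    show "R_mat L \<alpha> \<phi> $$ (i, j) = (?A * U * V) $$ (i, j)"
      unfolding mult_V[OF mult_carrier_mat[OF A U] ij] AU[OF ij(1)]
      using ij assms(1) by (auto simp: R_mat_def V_def)
  qed (use A U V in \<open>auto simp: R_mat_def\<close>)
  then have "M_mat L \<alpha> \<phi> \<psi> = A' * (?A * (U * V))"
    using A U V by (simp add: M_mat_def A' assoc_mult_mat[of _ "2 * L" "2 * L" _ 2 _ "2 * L"])
  also have "\<dots> = (A' * ?A) * (U * V)"
    using A U V inv(3) by (simp add: assoc_mult_mat[of _ "2 * L" "2 * L" _ "2 * L" _ "2 * L"])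
  also have "\<dots> = U * V"
    using U V inv(2) by simp
  finally have M: "M_mat L \<alpha> \<phi> \<psi> = U * V" .

  (* a and b are the real and the imaginary part of the first eigenvalue. *)
  define a where "a = (?g 1 - \<phi> * ?g 0) / (q - p)"
  define b where "b = \<psi> * ?g 0 / (q - p)"
  have "\<alpha> * ?g (L - 1) = ?g 1" "\<alpha> * ?g L = ?g 0"
    using green_reflection[OF sq pq(1) den, of 1] green_reflection[OF sq pq(1) den, of 0] assms(1)
    by simp_all
  then have "\<alpha> * (?g (L - 1) - \<phi> * ?g L) = ?g 1 - \<phi> * ?g 0"
    by (simp add: algebra_simps)
  moreover have "\<alpha> * \<phi> * x (L - 1) = \<alpha> * (?g (L - 1) - \<phi> * ?g L) / (q - p)"
    using assms(1,3) by (simp add: x_def corner_x_def)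
  ultimately have x_corner: "\<alpha> * \<phi> * x (L - 1) = a"
    by (simp only: a_def)
  have y_corner: "\<alpha> * \<phi> * y 0 = \<alpha> * b"
    using assms(3) by (simp add: y_def corner_y_def b_def)
  have "(V * U) $$ (0, c) = \<alpha> * \<phi> * U $$ (L - 1, c)" "(V * U) $$ (1, c) = \<alpha> * \<phi> * U $$ (L, c)"
    if "c < 2" for c
    using that U V assms(1) by (simp_all add: V_def scalar_prod_def if_distrib[of "\<lambda>t. t * _"] cong: if_cong)
  then have VU: "(V * U) $$ (0, 0) = a" "(V * U) $$ (0, 1) = - (\<alpha> * b)"
    "(V * U) $$ (1, 0) = \<alpha> * b" "(V * U) $$ (1, 1) = a"
    using assms(1) x_corner y_corner by (simp_all add: U_index[simplified] u_def w_def)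
  have "(\<alpha> * b) * (\<alpha> * b) = b\<^sup>2"
    using sq by (simp add: power2_eq_square mult_ac)
  then have "char_poly (V * U) = [:a\<^sup>2 + b\<^sup>2, - 2 * a, 1:]"
    using U V by (subst char_poly_2x2) (auto simp: VU[simplified] power2_eq_square)
  moreover have "[:0, 1 :: real:] ^ (2 * L) = [:0, 1:] ^ (2 * L - 2) * [:0, 1:]\<^sup>2"
    unfolding power_add[symmetric] by (rule arg_cong[where f = "power _"]) (use assms(1) in simp)
  ultimately have "char_poly (U * V) * [:0, 1:]\<^sup>2 = ([:a\<^sup>2 + b\<^sup>2, - 2 * a, 1:] * [:0, 1:] ^ (2 * L - 2)) * [:0, 1:]\<^sup>2"
    using char_poly_mult_swap[OF U V] by (simp only: mult.assoc)
  moreover have "[:0, 1 :: real:]\<^sup>2 \<noteq> 0" by simp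
  ultimately have M_poly: "char_poly (M_mat L \<alpha> \<phi> \<psi>) = [:a\<^sup>2 + b\<^sup>2, - 2 * a, 1:] * [:0, 1:] ^ (2 * L - 2)"
    unfolding M by (simp only: mult_cancel_right simp_thms)
  interpret of_real_poly_hom: map_poly_comm_ring_hom "of_real :: real \<Rightarrow> complex" ..
  have "M_mat L \<alpha> \<phi> \<psi> \<in> carrier_mat (2 * L) (2 * L)"
    unfolding M using U V by simp
  then have "char_poly (map_mat complex_of_real (M_mat L \<alpha> \<phi> \<psi>))
      = map_poly complex_of_real [:a\<^sup>2 + b\<^sup>2, - 2 * a, 1:] * map_poly complex_of_real [:0, 1:] ^ (2 * L - 2)"
    by (simp only: of_real_hom.char_poly_hom M_poly of_real_poly_hom.hom_mult of_real_poly_hom.hom_power)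
  also have "map_poly complex_of_real [:a\<^sup>2 + b\<^sup>2, - 2 * a, 1:] = [:- Complex a b, 1:] * [:- Complex a (- b), 1:]"
    by (simp add: power2_eq_square complex_eq_iff)
  also have "map_poly complex_of_real [:0, 1:] = [:- 0, 1:]"
    by simp
  finally have complex_poly: "char_poly (map_mat complex_of_real (M_mat L \<alpha> \<phi> \<psi>))
      = [:- Complex a b, 1:] * [:- Complex a (- b), 1:] * [:- 0, 1:] ^ (2 * L - 2)" .
  have "eigvals_mset (M_mat L \<alpha> \<phi> \<psi>) = {#Complex a b, Complex a (- b)#} + replicate_mset (2 * L - 2) 0"
    unfolding eigvals_mset_def complex_poly
    by (subst proots_mult, simp, simp, subst proots_mult, simp, simp) (simp add: proots_power)
  moreover have "omega1 L \<alpha> \<phi> \<psi> = Complex a b" "omega2 L \<alpha> \<phi> \<psi> = Complex a (- b)"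
    by (simp_all add: omega1_def omega2_def Let_def a_def b_def green_def Complex_eq
        add_divide_distrib diff_divide_distrib algebra_simps flip: p_def q_def)
  ultimately show ?thesis using invertible by simp
qed

end
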